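(* Let $H \in \mathbb{N}$ have Zeckendorf expansion \[ H = F_{m_0} + F_{m_1} + \cdots + F_{m_k}, \] where $k \ge 0$, $m_{i-1} - m_i \ge 2$ for $1 \le i \le k$, and $m_k \ge 2$. Write \[ x_\ell = F_{m_\ell} + \cdots + F_{m_k} \quad (0 \le \ell \le k+1) \] (so $x_{k+1} = 0$), and \[ t_i = \Big\lfloor \frac{m_{i-1} - m_i + 2}{2} \Big\rfloor, \qquad \varepsilon_i = 2t_i - 1 - m_{i-1} + m_i \qquad (1 \le i \le k), \] \[ a_0 = 1, \qquad a_1 = t_1, \qquad a_{\ell+1} = t_{\ell+1} a_\ell - \varepsilon_\ell a_{\ell-1} \quad (1 \le \ell \le k-1). \] Then for $\ell = 1, 2, \ldots, k$ we have \[ A(H) = a_\ell A(x_\ell) - \varepsilon_\ell a_{\ell-1} A(x_{\ell+1}) + \sum_{i \le \ell} a_{i-1} f(t_i)\, 2^{m_{i-1} - 2t_i}. \] In particular \[ A(H) = \begin{cases} a_k \Big\lfloor \frac{2^{m_k}}{6} + \frac{m_k+1}{2} \Big\rfloor - \varepsilon_k a_{k-1} + \displaystyle\sum_{i \le k} a_{i-1} f(t_i)\, 2^{m_{i-1} - 2t_i}, & \text{if } k \ge 1,\\[2mm] \Big\lfloor \frac{2^{m_0}}{6} + \frac{m_0+1}{2} \Big\rfloor, & \text{if } k = 0. \end{cases} \]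
   Context: The Fibonacci numbers are $F_1 = F_2 = 1$, $F_{m+1} = F_m + F_{m-1}$. For $n \in \mathbb{Z}_{\ge 0}$, $R(n)$ is the number of solutions to $x_1 + \cdots + x_s = n$ with $s \in \mathbb{Z}_{\ge 0}$ and $x_1 < \cdots < x_s$ Fibonacci numbers (partitions of $n$ into distinct Fibonacci numbers; $R(0)=1$). For $H \in \mathbb{Z}$, $A(H) = \sum_{n=0}^{H} R(n)$ (so $A(H) = 0$ for $H < 0$). For $t \in \mathbb{N}$, $f(t) = 1 + \frac{2(4^{t-1} - 1)}{3}$. The Zeckendorf expansion of a positive integer is its unique representation as a sum of non-consecutive Fibonacci numbers $F_m$ with indices $m \ge 2$. Empty sums are $0$. *)

theory Defs
  imports Complex_Main "HOL-Number_Theory.Fib"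
begin

definition fib_numbers :: "nat set" where
  "fib_numbers = fib ` {1..}"

text \<open>A solution \<open>x\<^sub>1 < \<dots> < x\<^sub>s\<close>, with \<open>s \<ge> 0\<close> arbitrary, is a strictly increasing list.
  The value \<open>1 = F\<^sub>1 = F\<^sub>2\<close> can be used only once.\<close>

definition fib_R :: "nat \<Rightarrow> nat" where
  "fib_R n = card {xs :: nat list. sorted_wrt (<) xs \<and> set xs \<subseteq> fib_numbers \<and> sum_list xs = n}"

definition fib_A :: "int \<Rightarrow> nat" where
  "fib_A H = (\<Sum>n = 0..H. fib_R (nat n))"

definition zeck_f :: "nat \<Rightarrow> real" where
  "zeck_f t = 1 + 2 * (4 ^ (t - 1) - 1) / 3"

text \<open>An expansion \<open>F\<^bsub>m\<^sub>0\<^esub> + \<dots> + F\<^bsub>m\<^sub>k\<^esub>\<close> is given by its index sequence \<open>m\<close>, of which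
  only the values at \<open>0, \<dots>, k\<close> matter. The floor in \<open>zeck_t\<close> is nonnegative whenever
  \<open>m i \<le> m (i - 1)\<close>, so applying \<open>nat\<close> loses nothing there.\<close>

definition zeck_x :: "(nat \<Rightarrow> nat) \<Rightarrow> nat \<Rightarrow> nat \<Rightarrow> nat" where
  "zeck_x m k l = (\<Sum>i = l..k. fib (m i))"

definition zeck_t :: "(nat \<Rightarrow> nat) \<Rightarrow> nat \<Rightarrow> nat" where
  "zeck_t m i = nat \<lfloor>(real (m (i - 1)) - real (m i) + 2) / 2\<rfloor>"

definition zeck_eps :: "(nat \<Rightarrow> nat) \<Rightarrow> nat \<Rightarrow> int" where
  "zeck_eps m i = 2 * int (zeck_t m i) - 1 - int (m (i - 1)) + int (m i)"

fun zeck_a :: "(nat \<Rightarrow> nat) \<Rightarrow> nat \<Rightarrow> int" where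
  "zeck_a m 0 = 1"
| "zeck_a m (Suc 0) = int (zeck_t m 1)"
| "zeck_a m (Suc (Suc l)) =
     int (zeck_t m (Suc (Suc l))) * zeck_a m (Suc l) - zeck_eps m (Suc l) * zeck_a m l"

definition zeck_sum :: "(nat \<Rightarrow> nat) \<Rightarrow> nat \<Rightarrow> real" where
  "zeck_sum m l = (\<Sum>i = 1..l. real_of_int (zeck_a m (i - 1)) * zeck_f (zeck_t m i)
      * 2 powi (int (m (i - 1)) - 2 * int (zeck_t m i)))"

end

theory Submission
  imports Defs
begin

text \<open>Split the subsets of \<open>{F\<^sub>2, \<dots>, F\<^sub>j}\<close> with sum at most \<open>x\<close> according to whether they
  contain \<open>F\<^sub>j\<close>. For \<open>y < F\<^sub>q\<close>, the number \<open>G\<^sub>q\<close> of subsets of \<open>{F\<^sub>2, \<dots>, F\<^bsub>q-1\<^esub>}\<close> with sum at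
  most \<open>F\<^sub>q + y\<close> satisfies \<open>G\<^bsub>q+2\<^esub> = 2\<^bsup>q-1\<^esup> + A(y) + G\<^sub>q\<close>, because a subset avoiding the largest
  available number automatically meets the bound. Since \<open>A(F\<^sub>m + y) = A(y) + G\<^sub>m\<close>, iterating
  downwards from \<open>m\<^sub>0\<close> to \<open>m\<^sub>1\<close> in steps of two expresses \<open>A(x\<^sub>0)\<close> through \<open>A(x\<^sub>1)\<close>, \<open>A(x\<^sub>2)\<close> and a
  geometric sum; the term \<open>A(x\<^sub>2)\<close> survives only if \<open>m\<^sub>0 - m\<^sub>1\<close> is even.\<close>

section \<open>Subsets of the Fibonacci numbers with bounded sum\<close>

definition fib_count :: "nat \<Rightarrow> nat \<Rightarrow> nat" where
  "fib_count j x = card {S. S \<subseteq> fib ` {2..j} \<and> \<Sum>S \<le> x}"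

lemma fib_less_iff: "2 \<le> i \<Longrightarrow> fib i < fib j \<longleftrightarrow> i < j"
proof
  assume "2 \<le> i" "fib i < fib j"
  then show "i < j" by (metis fib_mono not_le)
next
  assume "2 \<le> i" "i < j"
  then have "fib (Suc i) \<le> fib j" by (intro fib_mono) simp
  moreover have "fib (Suc i) = fib i + fib (i - 1)" using \<open>2 \<le> i\<close> by (cases i) auto
  moreover have "0 < fib (i - 1)" using \<open>2 \<le> i\<close> by (simp add: fib_neq_0_nat)
  ultimately show "fib i < fib j" by linarith
qed

lemma fib_Suc_notin_image: "1 \<le> j \<Longrightarrow> fib (Suc j) \<notin> fib ` {2..j}"
proof
  assume "1 \<le> j" "fib (Suc j) \<in> fib ` {2..j}"
  then obtain i where "2 \<le> i" "i \<le> j" "fib (Suc j) = fib i" by auto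
  with fib_less_iff[of i "Suc j"] show False by simp
qed

lemma fib_count_Suc:
  assumes "1 \<le> j"
  shows "fib_count (Suc j) x =
    fib_count j x + (if fib (Suc j) \<le> x then fib_count j (x - fib (Suc j)) else 0)"
proof -
  let ?I = "fib ` {2..j}" and ?a = "fib (Suc j)"
  let ?U = "{S. S \<subseteq> ?I \<and> \<Sum>S \<le> x}" and ?V = "{S. S \<subseteq> ?I \<and> ?a + \<Sum>S \<le> x}"
  have notin: "?a \<notin> ?I" using assms by (rule fib_Suc_notin_image)
  have I: "fib ` {2..Suc j} = insert ?a ?I"
    using assms by (simp add: atLeastAtMostSuc_conv)
  have fin: "finite S" if "S \<subseteq> ?I" for S using that finite_subset by blast
  have sum: "\<Sum>(insert ?a S) = ?a + \<Sum>S" if "S \<subseteq> ?I" for S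
    using that notin fin[OF that] by (subst sum.insert) auto
  have "{S. S \<subseteq> insert ?a ?I \<and> \<Sum>S \<le> x} = ?U \<union> insert ?a ` ?V" (is "?L = ?R")
  proof (intro equalityI subsetI)
    fix S assume S: "S \<in> ?L"
    show "S \<in> ?R"
    proof (cases "?a \<in> S")
      case True
      then have "S = insert ?a (S - {?a})" by blast
      moreover have "S - {?a} \<subseteq> ?I" using S by blast
      moreover have "?a + \<Sum>(S - {?a}) \<le> x"
        using S sum[OF calculation(2)] calculation(1) by auto
      ultimately show ?thesis by blast
    qed (use S in auto)
  next
    fix S assume "S \<in> ?R"
    then show "S \<in> ?L" using sum by auto
  qed
  moreover have "?U \<inter> insert ?a ` ?V = {}" using notin by blast
  moreover have "finite ?U" "finite ?V" by (auto intro: finite_subset[of _ "Pow ?I"])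
  moreover have "card (insert ?a ` ?V) = card ?V"
    using notin by (intro card_image inj_onI) (metis (no_types, lifting) insert_ident mem_Collect_eq subsetD)
  ultimately have "fib_count (Suc j) x = fib_count j x + card ?V"
    unfolding fib_count_def I by (simp add: card_Un_disjoint)
  moreover have "card ?V = (if ?a \<le> x then fib_count j (x - ?a) else 0)"
    unfolding fib_count_def by (auto simp: le_diff_conv2 add.commute intro!: arg_cong[where f = card])
  ultimately show ?thesis by simp
qed

text \<open>Since F_2 + ... + F_j = F_(j+2) - 2, the hypothesis on x says exactly that every subset
  fits; the 2 stands on the right to avoid truncated subtraction.\<close>

lemma fib_count_full:
  "1 \<le> j \<Longrightarrow> fib (j + 2) \<le> x + 2 \<Longrightarrow> fib_count j x = 2 ^ (j - 1)"
proof (induction j arbitrary: x rule: nat_induct_at_least)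
  case base
  have "{S :: nat set. S = {} \<and> \<Sum>S \<le> x} = {{}}" by auto
  then show ?case by (simp add: fib_count_def)
next
  case (Suc j)
  have "fib 3 \<le> fib (j + 2)" using Suc.hyps by (intro fib_mono) simp
  then have "2 \<le> fib (j + 2)" by (simp add: numeral_3_eq_3)
  moreover have "fib (Suc j + 2) = fib (j + 2) + fib (Suc j)" by simp
  \<comment> \<open>Both counts in \<open>fib_count_Suc\<close> satisfy the bound again, so each is
    half of the total.\<close>
  ultimately have "fib (Suc j) \<le> x" "fib (j + 2) \<le> x + 2" "fib (j + 2) \<le> x - fib (Suc j) + 2"
    using Suc.prems by linarith+
  then show ?case
    using Suc.hyps Suc.IH by (cases j) (auto simp: fib_count_Suc)
qed

section \<open>From partitions to set counts\<close>

lemma fib_A_conv_card: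
  "fib_A (int x) = card {S. finite S \<and> S \<subseteq> fib_numbers \<and> \<Sum>S \<le> x}"
proof -
  let ?T = "\<lambda>n. {S. finite S \<and> S \<subseteq> fib_numbers \<and> \<Sum>S = n}"
  have "bij_betw set {xs. sorted_wrt (<) xs \<and> set xs \<subseteq> fib_numbers \<and> sum_list xs = n} (?T n)" for n
  proof (rule bij_betw_imageI)
    show "inj_on set {xs. sorted_wrt (<) xs \<and> set xs \<subseteq> fib_numbers \<and> sum_list xs = n}"
      by (intro inj_onI) (auto intro: strict_sorted_equal)
    have "S \<in> set ` {xs. sorted_wrt (<) xs \<and> set xs \<subseteq> fib_numbers \<and> sum_list xs = n}"
      if "S \<in> ?T n" for S
      using that
      by (intro image_eqI[of _ _ "sorted_list_of_set S"]) (auto simp: distinct_sum_list_conv_Sum)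
    then show "set ` {xs. sorted_wrt (<) xs \<and> set xs \<subseteq> fib_numbers \<and> sum_list xs = n} = ?T n"
      by (auto simp: strict_sorted_iff distinct_sum_list_conv_Sum)
  qed
  then have R: "fib_R n = card (?T n)" for n
    unfolding fib_R_def by (rule bij_betw_same_card)
  have fin: "finite (?T n)" for n
  proof (rule finite_subset)
    \<comment> \<open>Every member of a finite set of naturals is at most its sum.\<close>
    show "?T n \<subseteq> Pow {..n}" by (auto intro: member_le_sum)
  qed simp
  have "fib_A (int x) = (\<Sum>n\<in>{0..x}. fib_R n)"
    unfolding fib_A_def by (rule sum.reindex_bij_witness[of _ int nat]) auto
  also have "\<dots> = card (\<Union>n\<in>{0..x}. ?T n)"
    unfolding R using fin by (subst card_UN_disjoint) auto
  also have "(\<Union>n\<in>{0..x}. ?T n) = {S. finite S \<and> S \<subseteq> fib_numbers \<and> \<Sum>S \<le> x}"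
    by auto
  finally show ?thesis .
qed

text \<open>No member of a set with sum at most x exceeds x, so all indices can be taken in
  \<open>{2..j}\<close>.\<close>

lemma fib_A_eq_fib_count:
  assumes "1 \<le> j" "x < fib (Suc j)"
  shows "fib_A (int x) = fib_count j x"
proof -
  have "S \<subseteq> fib ` {2..j}" if S: "finite S" "S \<subseteq> fib_numbers" "\<Sum>S \<le> x" for S
  proof
    fix s assume "s \<in> S"
    then obtain i where i: "s = fib i" "1 \<le> i" using S by (auto simp: fib_numbers_def)
    have "s \<le> \<Sum>S" using S \<open>s \<in> S\<close> by (intro member_le_sum) auto
    then have "fib i < fib (Suc j)" using S i assms by simp
    show "s \<in> fib ` {2..j}"
    proof (cases "i = 1")
      \<comment> \<open>The value 1 coming from index 1 is rewritten as \<open>fib 2\<close>, which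
        needs \<open>2 \<le> j\<close>; for \<open>j = 1\<close> the bound x < 1 excludes
        it.\<close>
      case True
      have "x < 1" if "j = 1" using assms that by simp
      then have "2 \<le> j" using \<open>s \<le> \<Sum>S\<close> S i True assms(1) by fastforce
      moreover have "s = fib 2" using i True by (simp add: numeral_2_eq_2)
      ultimately show ?thesis by (metis atLeastAtMost_iff imageI order_refl)
    next
      case False
      with i \<open>fib i < fib (Suc j)\<close> show ?thesis by (simp add: fib_less_iff)
    qed
  qed
  moreover have "finite S \<and> S \<subseteq> fib_numbers" if "S \<subseteq> fib ` {2..j}" for S
    using that by (auto simp: fib_numbers_def intro: finite_subset)
  ultimately show ?thesis
    unfolding fib_A_conv_card fib_count_def by (intro arg_cong[where f = card]) blast
qed

section \<open>Values at sums of Fibonacci numbers\<close>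

lemma fib_A_0: "fib_A 0 = 1"
  using fib_A_eq_fib_count[of 1 0] fib_count_full[of 1 0] by simp

text \<open>The bound on y keeps the argument below \<open>fib (q + 3)\<close>, so
  \<open>fib (q + 2)\<close> is the largest usable number. Sets containing it give
  \<open>fib_A\<close> of y, the others the G_(q+2) of the outline.\<close>

lemma fib_A_fib_add:
  assumes "y < fib (Suc q)"
  shows "fib_A (int (fib (q + 2) + y)) = fib_A (int y) + fib_count (Suc q) (fib (q + 2) + y)"
proof -
  have "y < fib (q + 2)" using assms by simp
  then have "fib_A (int y) = fib_count (Suc q) y" by (intro fib_A_eq_fib_count) auto
  moreover have "fib_A (int (fib (q + 2) + y)) = fib_count (Suc (Suc q)) (fib (q + 2) + y)"
    using assms by (intro fib_A_eq_fib_count) auto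
  ultimately show ?thesis by (simp add: fib_count_Suc)
qed

text \<open>Two splits, at F_(q+3) and then at F_(q+2); sets avoiding F_(q+3) all fit. Stated for
  all y, because the even gap uses it with y at least F_(q+2), where
  \<open>fib_count (Suc q) y\<close> differs from \<open>fib_A\<close> of y.\<close>

lemma fib_count_step_aux:
  "fib_count (q + 3) (fib (q + 4) + y) =
    2 ^ (q + 1) + fib_count (Suc q) y + fib_count (Suc q) (fib (q + 2) + y)"
proof -
  have "fib_count (q + 2) (fib (q + 4) + y) = 2 ^ (q + 1)"
    by (subst fib_count_full) (auto simp: eval_nat_numeral)
  moreover have "fib (q + 4) + y = fib (q + 3) + (fib (q + 2) + y)"
    by (simp add: eval_nat_numeral)
  ultimately have "fib_count (q + 3) (fib (q + 4) + y) =
      2 ^ (q + 1) + fib_count (q + 2) (fib (q + 2) + y)"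
    using fib_count_Suc[of "q + 2" "fib (q + 4) + y"] by (simp add: numeral_3_eq_3 ac_simps)
  moreover have "fib_count (q + 2) (fib (q + 2) + y) =
      fib_count (Suc q) y + fib_count (Suc q) (fib (q + 2) + y)"
    using fib_count_Suc[of "q + 1" "fib (q + 2) + y"] by simp
  ultimately show ?thesis by simp
qed

lemma fib_count_step:
  assumes "y < fib (q + 2)"
  shows "fib_count (q + 3) (fib (q + 4) + y) =
    2 ^ (q + 1) + fib_A (int y) + fib_count (Suc q) (fib (q + 2) + y)"
  using fib_A_eq_fib_count[of "Suc q" y] assms fib_count_step_aux[of q y] by simp

text \<open>Each step of two indices adds one \<open>fib_A\<close> of y and a power of two that is
  four times the previous one, hence the geometric sum.\<close>

lemma fib_count_iterate:
  assumes "y < fib (q + 2)"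
  shows "real (fib_count (q + 2 * s + 1) (fib (q + 2 * s + 2) + y)) =
    real s * real (fib_A (int y)) + 2 ^ (q + 1) * (4 ^ s - 1) / 3
    + real (fib_count (q + 1) (fib (q + 2) + y))"
proof (induction s)
  case (Suc s)
  have "fib (q + 2) \<le> fib (q + 2 * s + 2)" by (intro fib_mono) simp
  with assms have "y < fib (q + 2 * s + 2)" by linarith
  from fib_count_step[OF this]
  have "fib_count (q + 2 * Suc s + 1) (fib (q + 2 * Suc s + 2) + y) =
      2 ^ (q + 2 * s + 1) + fib_A (int y) + fib_count (q + 2 * s + 1) (fib (q + 2 * s + 2) + y)"
    by (simp add: eval_nat_numeral)
  moreover have "(2 :: real) ^ (q + 2 * s + 1) = 2 ^ (q + 1) * 4 ^ s"
    by (simp add: power_add power_mult)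
  ultimately show ?case using Suc.IH by (simp add: field_simps)
qed simp

text \<open>The descent stops at index q + 3. As y is at least F_(q+2), the remaining bound is at
  least F_(q+4) and all \<open>2 ^ (q + 1)\<close> subsets fit, so \<open>fib_A\<close> of z never
  appears.\<close>

lemma fib_A_odd_gap:
  assumes "1 \<le> s" "z < fib (q + 1)" and y_eq: "y = fib (q + 2) + z"
  shows "real (fib_A (int (fib (q + 2 + (2 * s + 1)) + y))) =
    (real s + 1) * real (fib_A (int y)) + (1 + 2 * (4 ^ s - 1) / 3) * 2 ^ (q + 1)"
proof -
  have y: "y < fib (q + 3)" using assms by (simp add: eval_nat_numeral)
  also have "fib (q + 3) \<le> fib (Suc (q + 1 + 2 * s))" using assms(1) by (intro fib_mono) simp
  finally have "fib_A (int (fib (q + 1 + 2 * s + 2) + y)) =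
      fib_A (int y) + fib_count (q + 1 + 2 * s + 1) (fib (q + 1 + 2 * s + 2) + y)"
    by (simp only: fib_A_fib_add Suc_eq_plus1)
  moreover have "fib_count (q + 1 + 1) (fib (q + 1 + 2) + y) = 2 ^ (q + 1)"
    by (subst fib_count_full) (auto simp: y_eq eval_nat_numeral)
  moreover have "q + 2 + (2 * s + 1) = q + 1 + 2 * s + 2" by simp
  ultimately show ?thesis
    using fib_count_iterate[of y "q + 1" s] y by (simp add: field_simps numeral_3_eq_3)
qed

text \<open>Here y is too large for \<open>fib_count_step\<close> in the last step, so the iteration
  stops at index q + 4 and \<open>fib_count_step_aux\<close> finishes. Its term
  \<open>fib_count (Suc q) y\<close> is \<open>fib_A\<close> of y minus \<open>fib_A\<close> of z,
  the source of the correction.\<close>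

lemma fib_A_even_gap:
  assumes "1 \<le> s" and z: "z < fib (q + 1)" and y_eq: "y = fib (q + 2) + z"
  shows "real (fib_A (int (fib (q + 2 + 2 * s) + y))) =
    (real s + 1) * real (fib_A (int y)) - real (fib_A (int z)) + (1 + 2 * (4 ^ s - 1) / 3) * 2 ^ q"
proof -
  obtain r where s: "s = Suc r" using assms(1) by (cases s) auto
  have y: "y < fib (q + 3)" using assms by (simp add: eval_nat_numeral)
  also have "fib (q + 3) \<le> fib (Suc (q + 2 + 2 * r))" by (intro fib_mono) simp
  finally have 1: "fib_A (int (fib (q + 2 + 2 * r + 2) + y)) =
      fib_A (int y) + fib_count (q + 2 + 2 * r + 1) (fib (q + 2 + 2 * r + 2) + y)"
    by (simp only: fib_A_fib_add Suc_eq_plus1)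
  have "fib (q + 3) \<le> fib (q + 2 + 2)" by (intro fib_mono) simp
  with y have 2: "y < fib (q + 2 + 2)" by linarith
  have "fib_count (Suc q) (fib (q + 2) + y) = 2 ^ q"
    by (subst fib_count_full) (auto simp: y_eq eval_nat_numeral)
  moreover have "fib_A (int y) = fib_A (int z) + fib_count (Suc q) y"
    unfolding y_eq using z by (intro fib_A_fib_add) simp
  ultimately have "real (fib_count (q + 2 + 1) (fib (q + 2 + 2) + y)) =
      2 ^ (q + 1) + (real (fib_A (int y)) - real (fib_A (int z))) + 2 ^ q"
    using fib_count_step_aux[of q y] by (simp add: eval_nat_numeral)
  moreover have "q + 2 + 2 * s = q + 2 + 2 * r + 2" by (simp add: s)
  ultimately show ?thesis
    using fib_count_iterate[OF 2, of r] 1 by (simp add: s field_simps)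
qed

text \<open>Merges the two parities: t is s + 1 in both, and the factor 2t - 1 - d is 1 for even d
  and 0 for odd d.\<close>

lemma fib_A_fib_fib_add:
  assumes "2 \<le> n" "2 \<le> d" "z < fib (n - 1)" and t: "t = (d + 2) div 2"
  shows "real (fib_A (int (fib (n + d) + (fib n + z)))) =
    real t * real (fib_A (int (fib n + z)))
    - (2 * real t - 1 - real d) * real (fib_A (int z))
    + zeck_f t * 2 powi (int (n + d) - 2 * int t)"
proof -
  obtain q where q: "n = q + 2" using assms(1) by (metis add.commute le_Suc_ex)
  have z: "z < fib (q + 1)" using assms(3) q by simp
  show ?thesis
  proof (cases "even d")
    case True
    then obtain s where s: "d = 2 * s" by blast
    have "int (n + d) - 2 * int t = int q" "t = s + 1" using s t q by simp_all
    then show ?thesis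
      using fib_A_even_gap[OF _ z refl, of s] assms(2) s q by (simp add: zeck_f_def)
  next
    case False
    then obtain s where s: "d = 2 * s + 1" using oddE by blast
    have "int (n + d) - 2 * int t = int (q + 1)" and t_eq: "t = s + 1" using s t q by simp_all
    then have pow: "2 powi (int (n + d) - 2 * int t) = (2 :: real) ^ (q + 1)"
      by (simp only: power_int_of_nat)
    show ?thesis
      unfolding pow using fib_A_odd_gap[OF _ z refl, of s] assms(2) s q t_eq
      by (simp add: zeck_f_def)
  qed
qed

text \<open>From n - 2 to n both sides grow by the integer 2^(n-3) + 1, which passes through the
  floor; the bases are n = 2 and n = 3.\<close>

lemma fib_A_fib:
  "2 \<le> n \<Longrightarrow> real (fib_A (int (fib n))) = real_of_int \<lfloor>2 ^ n / 6 + (real n + 1) / 2\<rfloor>"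
proof (induction n rule: less_induct)
  case (less n)
  consider "n = 2" | "n = 3" | q where "n = q + 4"
  proof -
    have "n = 2 \<or> n = 3 \<or> n = (n - 4) + 4" using less.prems by arith
    then show ?thesis using that by blast
  qed
  then show ?case
  proof cases
    case 1
    have "\<lfloor>(4 :: real) / 6 + 3 / 2\<rfloor> = 2" by (simp add: floor_eq_iff)
    moreover have "fib_count 1 1 = 1" by (subst fib_count_full) auto
    ultimately show ?thesis
      using fib_A_fib_add[of 0 0] fib_A_0 by (simp add: 1 numeral_2_eq_2)
  next
    case 2
    have "\<lfloor>(8 :: real) / 6 + 4 / 2\<rfloor> = 3" by (simp add: floor_eq_iff)
    moreover have "fib_count 2 2 = 2" by (subst fib_count_full) (auto simp: eval_nat_numeral)
    ultimately show ?thesis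
      using fib_A_fib_add[of 0 1] fib_A_0 by (simp add: 2 eval_nat_numeral)
  next
    case (3 q)
    have "fib_A (int (fib (q + 4))) = 1 + fib_count (q + 3) (fib (q + 4))"
      using fib_A_fib_add[of 0 "q + 2"] fib_A_0 by (simp add: fib_neq_0_nat eval_nat_numeral)
    also have "\<dots> = 1 + (2 ^ (q + 1) + 1 + fib_count (Suc q) (fib (q + 2)))"
      using fib_count_step[of 0 q] fib_A_0 by (simp add: fib_neq_0_nat)
    also have "\<dots> = 2 ^ (q + 1) + 1 + fib_A (int (fib (q + 2)))"
      using fib_A_fib_add[of 0 q] fib_A_0 by (simp add: fib_neq_0_nat)
    finally have "real (fib_A (int (fib n))) =
        real_of_int (2 ^ (q + 1) + 1 + \<lfloor>2 ^ (q + 2) / 6 + (real (q + 2) + 1) / 2\<rfloor>)"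
      using less.IH[of "q + 2"] 3 by simp
    also have "2 ^ (q + 1) + 1 + \<lfloor>2 ^ (q + 2) / 6 + (real (q + 2) + 1) / 2\<rfloor> =
        \<lfloor>2 ^ (q + 2) / 6 + (real (q + 2) + 1) / 2 + real_of_int (2 ^ (q + 1) + 1)\<rfloor>"
      by (subst floor_add_int[symmetric]) simp
    also have "2 ^ (q + 2) / 6 + (real (q + 2) + 1) / 2 + real_of_int (2 ^ (q + 1) + 1) =
        2 ^ n / 6 + (real n + 1) / 2"
      by (simp add: 3 field_simps power_add)
    finally show ?thesis .
  qed
qed

section \<open>Zeckendorf expansions\<close>

lemma zeck_t_eq:
  assumes "m i \<le> m (i - 1)"
  shows "zeck_t m i = (m (i - 1) - m i + 2) div 2"
proof -
  have "(real (m (i - 1)) - real (m i) + 2) / 2 = real (m (i - 1) - m i + 2) / real 2"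
    using assms by (simp add: of_nat_diff)
  then show ?thesis
    unfolding zeck_t_def by (simp only: floor_divide_of_nat_eq nat_int)
qed

lemma zeck_x_Suc: "i \<le> k \<Longrightarrow> zeck_x m k i = fib (m i) + zeck_x m k (Suc i)"
  by (simp add: zeck_x_def sum.atLeast_Suc_atMost)

text \<open>Supplies the bound on z in \<open>fib_A_fib_fib_add\<close>. Going down from
  \<open>i = k\<close>, the tail that starts with \<open>fib (m (Suc i))\<close> stays below
  \<open>fib (Suc (m (Suc i)))\<close>, and the gap makes this at most
  \<open>fib (m i - 1)\<close>.\<close>

lemma zeck_x_less:
  assumes gap: "\<And>i. 1 \<le> i \<Longrightarrow> i \<le> k \<Longrightarrow> int (m (i - 1)) - int (m i) \<ge> 2"
    and "m k \<ge> 2" "i \<le> k"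
  shows "m i \<ge> 2 \<and> zeck_x m k (Suc i) < fib (m i - 1)"
  using \<open>i \<le> k\<close>
proof (induction i rule: inc_induct)
  case base
  then show ?case using assms(2) by (simp add: zeck_x_def fib_neq_0_nat)
next
  case (step i)
  have d: "m (Suc i) + 2 \<le> m i" using gap[of "Suc i"] step.hyps by simp
  have "zeck_x m k (Suc i) < fib (m (Suc i)) + fib (m (Suc i) - 1)"
    using step by (simp add: zeck_x_Suc)
  also have "\<dots> = fib (Suc (m (Suc i)))" using step.IH by (cases "m (Suc i)") auto
  also have "\<dots> \<le> fib (m i - 1)" using d by (intro fib_mono) simp
  finally show ?case using d by simp
qed

theorem theorem1p2:
  fixes H k :: nat and m :: "nat \<Rightarrow> nat"
  assumes "H = (\<Sum>i = 0..k. fib (m i))"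
    and "\<And>i. 1 \<le> i \<Longrightarrow> i \<le> k \<Longrightarrow> int (m (i - 1)) - int (m i) \<ge> 2"
    and "m k \<ge> 2"
  shows "(\<forall>l. 1 \<le> l \<and> l \<le> k \<longrightarrow>
            real (fib_A (int H)) =
              real_of_int (zeck_a m l) * real (fib_A (int (zeck_x m k l)))
              - real_of_int (zeck_eps m l) * real_of_int (zeck_a m (l - 1))
                  * real (fib_A (int (zeck_x m k (l + 1))))
              + zeck_sum m l)
       \<and> real (fib_A (int H)) =
           (if k \<ge> 1 then
              real_of_int (zeck_a m k) * real_of_int \<lfloor>2 ^ m k / 6 + (real (m k) + 1) / 2\<rfloor>
              - real_of_int (zeck_eps m k) * real_of_int (zeck_a m (k - 1))
              + zeck_sum m k
            else real_of_int \<lfloor>2 ^ m 0 / 6 + (real (m 0) + 1) / 2\<rfloor>)"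
proof -
  let ?A = "\<lambda>l. real (fib_A (int (zeck_x m k l)))"
  let ?c = "\<lambda>i. zeck_f (zeck_t m i) * 2 powi (int (m (i - 1)) - 2 * int (zeck_t m i))"
  have H: "H = zeck_x m k 0" using assms(1) by (simp add: zeck_x_def)
  have step: "?A i = real (zeck_t m (Suc i)) * ?A (Suc i)
      - real_of_int (zeck_eps m (Suc i)) * ?A (Suc (Suc i)) + ?c (Suc i)" if "i < k" for i
  proof -
    define d where "d = m i - m (Suc i)"
    have gap: "m (Suc i) + 2 \<le> m i" using assms(2)[of "Suc i"] that by simp
    then have mi: "m i = m (Suc i) + d" "2 \<le> d" by (simp_all add: d_def)
    have t: "zeck_t m (Suc i) = (d + 2) div 2" using mi by (simp add: zeck_t_eq)
    have "real_of_int (zeck_eps m (Suc i)) = 2 * real (zeck_t m (Suc i)) - 1 - real d"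
      by (simp add: zeck_eps_def mi)
    then show ?thesis
      using fib_A_fib_fib_add[OF _ mi(2) _ t, of "m (Suc i)" "zeck_x m k (Suc (Suc i))"]
        zeck_x_less[OF assms(2,3), of "Suc i"] that mi(1)
      by (simp add: zeck_x_Suc)
  qed
  have main: "real (fib_A (int H)) =
      real_of_int (zeck_a m (Suc l)) * ?A (Suc l)
      - real_of_int (zeck_eps m (Suc l)) * real_of_int (zeck_a m l) * ?A (Suc (Suc l))
      + zeck_sum m (Suc l)" if "l < k" for l
    using that
  proof (induction l)
    case 0
    then show ?case using step[of 0] by (simp add: H zeck_sum_def)
  next
    case (Suc l)
    have "zeck_sum m (Suc (Suc l)) =
        zeck_sum m (Suc l) + real_of_int (zeck_a m (Suc l)) * ?c (Suc (Suc l))"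
      by (simp add: zeck_sum_def)
    \<comment> \<open>Expanding \<open>?A (Suc l)\<close> turns the coefficient of
      \<open>?A (Suc (Suc l))\<close> into the defining recursion of \<open>zeck_a\<close>.\<close>
    with Suc step[of "Suc l"] show ?case by (simp add: algebra_simps)
  qed
  have last: "?A k = real_of_int \<lfloor>2 ^ m k / 6 + (real (m k) + 1) / 2\<rfloor>"
    using fib_A_fib[OF assms(3)] by (simp add: zeck_x_def)
  \<comment> \<open>The tail past k is empty, so for l = k the middle term loses its last
    factor.\<close>
  have "?A (Suc k) = 1" by (simp add: zeck_x_def fib_A_0)
  moreover have rec: "real (fib_A (int H)) =
      real_of_int (zeck_a m l) * ?A l
      - real_of_int (zeck_eps m l) * real_of_int (zeck_a m (l - 1)) * ?A (l + 1)
      + zeck_sum m l" if "1 \<le> l" "l \<le> k" for l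
    using main[of "l - 1"] that by simp
  ultimately show ?thesis using last rec[of k] by (cases "k = 0") (simp_all add: H)
qed

end
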